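(* Fractal Cauer type networks with characteristics $\lambda_R$ and $\lambda_C$ are in one to one correspondence, for all $h>0$, with the discretization in space along the space-scale $\{kh\}$, $k\in\mathbb{N}$, of the diffusion equation with non-constant diffusion coefficient $$\partial_t u=-\gamma_0\, e^{-\lambda_C z}\,\partial_z\left(-\beta_0\, e^{-\lambda_R z}\,\partial_z u\right).$$
   Context: A Cauer type RC network is given by resistances $R(k)$ and capacitances $C(k)$ (values of real-valued functions on $\mathbb{N}$). With voltages $U(s,k)$ and currents $I(s,k)$ in the Laplace variable $s$, its relations are $-\frac{1}{R(k+1)}\big(U(s,k+1)-U(s,k)\big)=I(s,k)$ for $k\ge 0$ and $-\frac{1}{C(k)}\big(I(s,k)-I(s,k-1)\big)=sU(s,k)$ for $k\ge 1$. The network is called fractal if there are constants $\sigma,\rho$ with $R(k+1)=\sigma R(k)$ and $C(k+1)=\rho C(k)$. It has characteristics $\lambda_R,\lambda_C\in\mathbb{R}$ if $R(k)=r(kh)$ and $C(k)=c(kh)$ with $r(z)=R_0e^{\lambda_R z}$, $c(z)=C_0e^{\lambda_C z}$ for constants $R_0,C_0$; here $h$ is the space step and $\sigma,\rho$ depend on $h$. For a diffusion equation $\partial_t u=\gamma(z)\partial_z(\beta(z)\partial_z u)$, the Laplace transform in $t$ gives $sU=\gamma\,\partial_z(\beta\,\partial_z U)$, and its space discretization along $\{kh\}_{k\in\mathbb{N}}$ is $$sU_h(s,kh)=\gamma(kh)\,\Delta_-\big[\beta\,\Delta_+[U_h]\big](s,kh),\qquad k\ge 1,$$ where $\Delta_+[f](kh)=\frac{f((k+1)h)-f(kh)}{h}$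 and $\Delta_-[f](kh)=\frac{f(kh)-f((k-1)h)}{h}$. In the theorem $\beta(z)=-\beta_0e^{-\lambda_R z}$ and $\gamma(z)=-\gamma_0e^{-\lambda_C z}$ with constants $\beta_0,\gamma_0$. The correspondence is the one obtained by comparing the discretized equation with the network equation $sU(s,k)=-\frac{1}{C(k)}\Delta_-\big[-\frac{1}{R(k+1)}\Delta_+[U]\big](s,k)$, that is, by choosing $R$ and $C$ so that $-1/R(k+1)=\beta(kh)$ and $-1/C(k)=\gamma(kh)$. *)

theory Defs
  imports Complex_Main
begin

section \<open>Finite differences on a grid\<close>

text \<open>A function on the grid \<open>{k h}\<close> is encoded by the sequence of its values, so that
  \<open>f k\<close> stands for \<open>f(kh)\<close>. The backward difference is only meant for \<open>k \<ge> 1\<close>.\<close>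

definition fwd_diff :: "real \<Rightarrow> (nat \<Rightarrow> complex) \<Rightarrow> nat \<Rightarrow> complex" where
  "fwd_diff h f k = (f (k + 1) - f k) / of_real h"

definition bwd_diff :: "real \<Rightarrow> (nat \<Rightarrow> complex) \<Rightarrow> nat \<Rightarrow> complex" where
  "bwd_diff h f k = (f k - f (k - 1)) / of_real h"


section \<open>Cauer type networks\<close>

record cauer_network =
  res :: "nat \<Rightarrow> real"
  cap :: "nat \<Rightarrow> real"

text \<open>Here \<open>U\<close> and \<open>I\<close> are the voltages and currents at one value \<open>s\<close> of the Laplace variable.\<close>

definition cauer_relations ::
    "cauer_network \<Rightarrow> complex \<Rightarrow> (nat \<Rightarrow> complex) \<Rightarrow> (nat \<Rightarrow> complex) \<Rightarrow> bool" where
  "cauer_relations N s U I \<longleftrightarrow>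
     (\<forall>k. of_real (- (1 / res N (k + 1))) * (U (k + 1) - U k) = I k) \<and>
     (\<forall>k\<ge>1. of_real (- (1 / cap N k)) * (I k - I (k - 1)) = s * U k)"

text \<open>The network equation written with difference operators of step \<open>h\<close>. Eliminating \<open>I\<close> from
  \<open>cauer_relations\<close> gives this equation for step \<open>1\<close>; for another step the two differ by the
  factor \<open>h\<^sup>2\<close> in front of \<open>s\<close>.\<close>

definition network_equation :: "real \<Rightarrow> cauer_network \<Rightarrow> complex \<Rightarrow> (nat \<Rightarrow> complex) \<Rightarrow> bool" where
  "network_equation h N s U \<longleftrightarrow>
     (\<forall>k\<ge>1. s * U k =
        of_real (- (1 / cap N k)) *
        bwd_diff h (\<lambda>j. of_real (- (1 / res N (j + 1))) * fwd_diff h U j) k)"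

definition fractal :: "cauer_network \<Rightarrow> bool" where
  "fractal N \<longleftrightarrow>
     (\<exists>\<sigma> \<rho>. \<forall>k. res N (k + 1) = \<sigma> * res N k \<and> cap N (k + 1) = \<rho> * cap N k)"

text \<open>The constants are nonzero because the network relations divide by \<open>R(k)\<close> and \<open>C(k)\<close>.\<close>

definition has_characteristics :: "real \<Rightarrow> real \<Rightarrow> real \<Rightarrow> cauer_network \<Rightarrow> bool" where
  "has_characteristics h lR lC N \<longleftrightarrow>
     (\<exists>R0 C0. R0 \<noteq> 0 \<and> C0 \<noteq> 0 \<and>
        (\<forall>k. res N k = R0 * exp (lR * (real k * h)) \<and>
             cap N k = C0 * exp (lC * (real k * h))))"

definition fractal_networks :: "real \<Rightarrow> real \<Rightarrow> real \<Rightarrow> cauer_network set" where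
  "fractal_networks h lR lC = {N. fractal N \<and> has_characteristics h lR lC N}"


section \<open>Diffusion equations and their space discretization\<close>

text \<open>The diffusion equation \<open>\<partial>\<^sub>t u = \<gamma>(z) \<partial>\<^sub>z (\<beta>(z) \<partial>\<^sub>z u)\<close>, given by its coefficients:
  \<open>outer\<close> is \<open>\<gamma>\<close>, \<open>inner\<close> is \<open>\<beta>\<close>.\<close>

record diffusion =
  outer :: "real \<Rightarrow> real"
  inner :: "real \<Rightarrow> real"

definition exp_diffusion :: "real \<Rightarrow> real \<Rightarrow> real \<Rightarrow> real \<Rightarrow> diffusion" where
  "exp_diffusion lR lC \<beta>0 \<gamma>0 =
     \<lparr> outer = (\<lambda>z. - \<gamma>0 * exp (- lC * z)), inner = (\<lambda>z. - \<beta>0 * exp (- lR * z)) \<rparr>"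

text \<open>A discretized equation is kept together with the grid values \<open>\<gamma>(kh)\<close> and \<open>\<beta>(kh)\<close> of the two
  coefficients. Its solutions alone would not determine a network: in the exponential case they
  depend on \<open>\<beta>\<^sub>0\<close> and \<open>\<gamma>\<^sub>0\<close> only through the product \<open>\<beta>\<^sub>0 \<gamma>\<^sub>0\<close>.\<close>

record discretization =
  grid_outer :: "nat \<Rightarrow> real"
  grid_inner :: "nat \<Rightarrow> real"

definition discretize :: "real \<Rightarrow> diffusion \<Rightarrow> discretization" where
  "discretize h E =
     \<lparr> grid_outer = (\<lambda>k. outer E (real k * h)), grid_inner = (\<lambda>k. inner E (real k * h)) \<rparr>"

text \<open>\<open>s U\<^sub>h = \<gamma> \<Delta>\<^sub>-[\<beta> \<Delta>\<^sub>+[U\<^sub>h]]\<close> at the points \<open>kh\<close>, \<open>k \<ge> 1\<close>: the Laplace transformed diffusion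
  equation \<open>s U = \<gamma> \<partial>\<^sub>z (\<beta> \<partial>\<^sub>z U)\<close> with differences in place of the derivatives.\<close>

definition discretized_equation ::
    "real \<Rightarrow> discretization \<Rightarrow> complex \<Rightarrow> (nat \<Rightarrow> complex) \<Rightarrow> bool" where
  "discretized_equation h D s Uh \<longleftrightarrow>
     (\<forall>k\<ge>1. s * Uh k =
        of_real (grid_outer D k) *
        bwd_diff h (\<lambda>j. of_real (grid_inner D j) * fwd_diff h Uh j) k)"

definition exp_discretizations :: "real \<Rightarrow> real \<Rightarrow> real \<Rightarrow> discretization set" where
  "exp_discretizations h lR lC =
     {discretize h (exp_diffusion lR lC \<beta>0 \<gamma>0) | \<beta>0 \<gamma>0. \<beta>0 \<noteq> 0 \<and> \<gamma>0 \<noteq> 0}"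


section \<open>Comparison of the two equations\<close>

definition corresponds :: "cauer_network \<Rightarrow> discretization \<Rightarrow> bool" where
  "corresponds N D \<longleftrightarrow>
     (\<forall>k. - (1 / res N (k + 1)) = grid_inner D k) \<and>
     (\<forall>k\<ge>1. - (1 / cap N k) = grid_outer D k)"

end

theory Submission
  imports Defs
begin

text \<open>A network with characteristics has \<open>R(k) = R\<^sub>0 e\<^bsup>\<lambda>\<^sub>R k h\<^esup>\<close> and \<open>C(k) = C\<^sub>0 e\<^bsup>\<lambda>\<^sub>C k h\<^esup>\<close>; it is
  fractal with ratios \<open>\<sigma> = e\<^bsup>\<lambda>\<^sub>R h\<^esup>\<close> and \<open>\<rho> = e\<^bsup>\<lambda>\<^sub>C h\<^esup>\<close>. Comparing coefficients gives
  \<open>\<beta>\<^sub>0 = e\<^bsup>-\<lambda>\<^sub>R h\<^esup> / R\<^sub>0\<close>, where the shift by one step comes from \<open>R(k + 1)\<close>, and \<open>\<gamma>\<^sub>0 = 1 / C\<^sub>0\<close>.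
  This is a bijection between the pairs \<open>(R\<^sub>0, C\<^sub>0)\<close> and \<open>(\<beta>\<^sub>0, \<gamma>\<^sub>0)\<close> of nonzero reals, and the
  comparison leaves out only \<open>R(0)\<close> and \<open>\<gamma>(0)\<close>, which the exponential form recovers.\<close>

text \<open>The formula for the outer coefficient is also used at \<open>k = 0\<close>, a value that
  \<open>corresponds\<close> leaves open; this choice sends exponential networks to exponential
  discretizations.\<close>

definition network_discretization :: "cauer_network \<Rightarrow> discretization" where
  "network_discretization N =
     \<lparr> grid_outer = (\<lambda>k. - (1 / cap N k)), grid_inner = (\<lambda>k. - (1 / res N (k + 1))) \<rparr>"

definition exp_network :: "real \<Rightarrow> real \<Rightarrow> real \<Rightarrow> real \<Rightarrow> real \<Rightarrow> cauer_network" where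
  "exp_network h lR lC R0 C0 =
     \<lparr> res = (\<lambda>k. R0 * exp (lR * (real k * h))), cap = (\<lambda>k. C0 * exp (lC * (real k * h))) \<rparr>"

lemma fractal_exp_network: "fractal (exp_network h lR lC R0 C0)"
  unfolding fractal_def
proof (intro exI allI)
  fix k
  show "res (exp_network h lR lC R0 C0) (k + 1) = exp (lR * h) * res (exp_network h lR lC R0 C0) k \<and>
    cap (exp_network h lR lC R0 C0) (k + 1) = exp (lC * h) * cap (exp_network h lR lC R0 C0) k"
    by (simp add: exp_network_def algebra_simps exp_add)
qed

lemma has_characteristics_iff:
  "has_characteristics h lR lC N \<longleftrightarrow>
     (\<exists>R0 C0. R0 \<noteq> 0 \<and> C0 \<noteq> 0 \<and> N = exp_network h lR lC R0 C0)"
  unfolding has_characteristics_def exp_network_def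
  by (cases N) (simp add: fun_eq_iff all_conj_distrib)

lemma fractal_networks_eq:
  "fractal_networks h lR lC = {exp_network h lR lC R0 C0 | R0 C0. R0 \<noteq> 0 \<and> C0 \<noteq> 0}"
  by (auto simp: fractal_networks_def has_characteristics_iff fractal_exp_network)

lemma discretize_exp_diffusion_eq_iff:
  "discretize h (exp_diffusion lR lC \<beta>0 \<gamma>0) = discretize h (exp_diffusion lR lC \<beta>1 \<gamma>1) \<longleftrightarrow>
     \<beta>0 = \<beta>1 \<and> \<gamma>0 = \<gamma>1"
  by (simp add: discretize_def exp_diffusion_def fun_eq_iff conj_commute)

lemma network_discretization_exp_network:
  "network_discretization (exp_network h lR lC R0 C0) =
     discretize h (exp_diffusion lR lC (exp (- lR * h) / R0) (1 / C0))"
  by (simp add: network_discretization_def exp_network_def discretize_def exp_diffusion_def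
      fun_eq_iff algebra_simps exp_add exp_minus divide_simps)

lemma bij_betw_network_discretization:
  "bij_betw network_discretization (fractal_networks h lR lC) (exp_discretizations h lR lC)"
proof (rule bij_betwI')
  fix N M
  assume "N \<in> fractal_networks h lR lC" "M \<in> fractal_networks h lR lC"
  then show "network_discretization N = network_discretization M \<longleftrightarrow> N = M"
    by (auto simp: fractal_networks_eq network_discretization_exp_network
        discretize_exp_diffusion_eq_iff)
next
  fix N
  assume "N \<in> fractal_networks h lR lC"
  then obtain R0 C0 where "R0 \<noteq> 0" "C0 \<noteq> 0" "N = exp_network h lR lC R0 C0"
    by (auto simp: fractal_networks_eq)
  then have "exp (- lR * h) / R0 \<noteq> 0" "1 / C0 \<noteq> 0"
      "network_discretization N = discretize h (exp_diffusion lR lC (exp (- lR * h) / R0) (1 / C0))"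
    by (simp_all add: network_discretization_exp_network)
  then show "network_discretization N \<in> exp_discretizations h lR lC"
    unfolding exp_discretizations_def by blast
next
  fix D
  assume "D \<in> exp_discretizations h lR lC"
  then obtain \<beta>0 \<gamma>0 where
    D: "\<beta>0 \<noteq> 0" "\<gamma>0 \<noteq> 0" "D = discretize h (exp_diffusion lR lC \<beta>0 \<gamma>0)"
    by (auto simp: exp_discretizations_def)
  \<comment> \<open>The witness solves \<open>\<beta>0 = exp (- lR * h) / R0\<close> and
    \<open>\<gamma>0 = 1 / C0\<close> for \<open>R0\<close> and \<open>C0\<close>; each formula is
    its own inverse.\<close>
  have "D = network_discretization (exp_network h lR lC (exp (- lR * h) / \<beta>0) (1 / \<gamma>0))"
    by (simp add: D network_discretization_exp_network)
  moreover have "exp_network h lR lC (exp (- lR * h) / \<beta>0) (1 / \<gamma>0) \<in> fractal_networks h lR lC"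
  proof -
    have "exp (- lR * h) / \<beta>0 \<noteq> 0" "1 / \<gamma>0 \<noteq> 0"
      using D by simp_all
    then show ?thesis
      unfolding fractal_networks_eq by blast
  qed
  ultimately show "\<exists>N\<in>fractal_networks h lR lC. D = network_discretization N" ..
qed

lemma corresponds_iff:
  "corresponds N D \<longleftrightarrow>
     grid_inner D = grid_inner (network_discretization N) \<and>
     (\<forall>k\<ge>1. grid_outer D k = grid_outer (network_discretization N) k)"
  unfolding corresponds_def network_discretization_def fun_eq_iff
  by (auto simp: eq_commute)

text \<open>The value \<open>\<gamma>(0)\<close> is not compared, but \<open>\<gamma>(h)\<close> already determines \<open>\<gamma>\<^sub>0\<close>.\<close>

lemma exp_discretization_eqI:
  assumes "D \<in> exp_discretizations h lR lC" and "E \<in> exp_discretizations h lR lC"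
    and inner: "grid_inner D = grid_inner E"
    and outer: "grid_outer D 1 = grid_outer E 1"
  shows "D = E"
proof -
  obtain \<beta>0 \<gamma>0 \<beta>1 \<gamma>1 where
    DE: "D = discretize h (exp_diffusion lR lC \<beta>0 \<gamma>0)" "E = discretize h (exp_diffusion lR lC \<beta>1 \<gamma>1)"
    using assms(1,2) by (auto simp: exp_discretizations_def)
  have "\<beta>0 = \<beta>1"
    using fun_cong[OF inner, of 0] by (simp add: DE discretize_def exp_diffusion_def)
  moreover have "\<gamma>0 = \<gamma>1"
    using outer by (simp add: DE discretize_def exp_diffusion_def)
  ultimately show ?thesis
    by (simp add: DE)
qed

text \<open>Correspondence fixes everything except the outer value at \<open>k = 0\<close>. Since
  both discretizations are exponential, agreement at \<open>k = 1\<close> fills this gap.\<close>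

lemma corresponds_iff_network_discretization:
  assumes "N \<in> fractal_networks h lR lC" and "D \<in> exp_discretizations h lR lC"
  shows "corresponds N D \<longleftrightarrow> D = network_discretization N"
proof
  assume "corresponds N D"
  moreover have "network_discretization N \<in> exp_discretizations h lR lC"
    using bij_betw_apply[OF bij_betw_network_discretization assms(1)] .
  ultimately show "D = network_discretization N"
    using exp_discretization_eqI[OF assms(2)] by (simp add: corresponds_iff)
qed (simp add: corresponds_iff)

lemma network_equation_iff:
  "network_equation h N s U \<longleftrightarrow> discretized_equation h (network_discretization N) s U"
  by (simp add: network_equation_def discretized_equation_def network_discretization_def)

text \<open>The first relation determines the current from the voltage, so \<open>I\<close> can be
  eliminated. Each of the two difference quotients contributes a factor \<open>1 / h\<close>, and
  together they account for the factor \<open>h\<^sup>2\<close> at \<open>s\<close>.\<close>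

lemma cauer_relations_iff_network_equation:
  assumes "h \<noteq> 0"
  shows "(\<exists>I. cauer_relations N ((of_real h)\<^sup>2 * s) U I) \<longleftrightarrow> network_equation h N s U"
proof -
  \<comment> \<open>\<open>J\<close> is the only current that the first relation admits.\<close>
  define J where "J = (\<lambda>k. of_real (- (1 / res N (k + 1))) * (U (k + 1) - U k))"
  define c :: "nat \<Rightarrow> complex" where "c = (\<lambda>k. of_real (- (1 / cap N k)))"
  have flux: "of_real (- (1 / res N (k + 1))) * fwd_diff h U k = J k / of_real h" for k
    by (simp add: J_def fwd_diff_def)
  have bwd: "c k * bwd_diff h (\<lambda>j. J j / of_real h) k =
      c k * (J k - J (k - 1)) / (of_real h)\<^sup>2" for k
    by (simp add: bwd_diff_def diff_divide_distrib right_diff_distrib power2_eq_square)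
  have rel: "cauer_relations N t U I \<longleftrightarrow> J = I \<and> (\<forall>k\<ge>1. c k * (I k - I (k - 1)) = t * U k)" for t I
    unfolding cauer_relations_def J_def c_def fun_eq_iff by (rule refl)
  have "(\<exists>I. cauer_relations N ((of_real h)\<^sup>2 * s) U I) \<longleftrightarrow>
      (\<forall>k\<ge>1. c k * (J k - J (k - 1)) = (of_real h)\<^sup>2 * s * U k)"
    by (simp only: rel simp_thms)
  also have "\<dots> \<longleftrightarrow> (\<forall>k\<ge>1. s * U k = c k * bwd_diff h (\<lambda>j. J j / of_real h) k)"
    unfolding bwd using assms by (simp add: eq_divide_eq mult_ac) (metis mult.commute)
  also have "\<dots> \<longleftrightarrow> network_equation h N s U"
    unfolding network_equation_def flux c_def ..
  finally show ?thesis .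
qed

text \<open>The inner coefficient does not see \<open>res N 0\<close>, but all resistances share the
  sign of \<open>R0\<close>, because exponentials are positive.\<close>

lemma positive_iff_network_discretization_negative:
  assumes "N \<in> fractal_networks h lR lC"
  shows "(\<forall>k. res N k > 0 \<and> cap N k > 0) \<longleftrightarrow>
    (\<forall>k. grid_inner (network_discretization N) k < 0 \<and> grid_outer (network_discretization N) k < 0)"
  using assms
  by (auto simp: fractal_networks_eq network_discretization_def exp_network_def
      zero_less_mult_iff zero_less_divide_iff)

text \<open>The second conjunct pins \<open>\<Phi>\<close> down on the networks as the comparison of
  coefficients, so the bijection is not an arbitrary one. The last conjunct matches physical
  networks with \<open>\<beta>0 > 0\<close> and \<open>\<gamma>0 > 0\<close>.\<close>

theorem theorem5p3:
  fixes lR lC h :: real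
  assumes "h > 0"
  shows "\<exists>\<Phi>. bij_betw \<Phi> (fractal_networks h lR lC) (exp_discretizations h lR lC) \<and>
    (\<forall>N\<in>fractal_networks h lR lC. \<forall>D\<in>exp_discretizations h lR lC.
       corresponds N D \<longleftrightarrow> D = \<Phi> N) \<and>
    (\<forall>N\<in>fractal_networks h lR lC.
       (\<forall>s U. network_equation h N s U \<longleftrightarrow> discretized_equation h (\<Phi> N) s U) \<and>
       (\<forall>s U. (\<exists>I. cauer_relations N ((of_real h)\<^sup>2 * s) U I) \<longleftrightarrow>
          discretized_equation h (\<Phi> N) s U) \<and>
       ((\<forall>k. res N k > 0 \<and> cap N k > 0) \<longleftrightarrow>
          (\<forall>k. grid_inner (\<Phi> N) k < 0 \<and> grid_outer (\<Phi> N) k < 0)))"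
proof (intro exI conjI ballI allI)
  show "bij_betw network_discretization (fractal_networks h lR lC) (exp_discretizations h lR lC)"
    by (rule bij_betw_network_discretization)
next
  fix N s U
  show "(\<exists>I. cauer_relations N ((of_real h)\<^sup>2 * s) U I) \<longleftrightarrow>
      discretized_equation h (network_discretization N) s U"
    using assms by (simp add: cauer_relations_iff_network_equation network_equation_iff)
qed (rule corresponds_iff_network_discretization network_equation_iff
    positive_iff_network_discretization_negative; assumption)+

end
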